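(* Let a model's parameter vector $w \in \mathbb{R}^d$ be partitioned into two disjoint sets of coordinates, $w = (w_A, w_B)$ with $w_A \in \mathbb{R}^{d_A}$, $w_B \in \mathbb{R}^{d_B}$, $d_A + d_B = d$. Let the finite training dataset $\mathcal{D}$ be partitioned into two disjoint sets, $\mathcal{D} = \mathcal{D}_A \cup \mathcal{D}_B$. Let $\ell(z; w) \in \mathbb{R}$ denote the per-sample loss of data point $z$ at parameter $w$, and assume that for every $z \in \mathcal{D}_A$ the loss $\ell(z; w)$ is a function of $w_A$ only (written $\ell(z; w_A)$), and that for every $z' \in \mathcal{D}_B$ the loss $\ell(z'; w)$ is a function of $w_B$ only (written $\ell(z'; w_B)$). Let $w^* \in \mathbb{R}^d$, $\beta > 0$, $\gamma > 0$, and let $p(w \mid \mathcal{D})$ be the probe distribution with these parameters. Then for every $z \in \mathcal{D}_A$ and every $z' \in \mathcal{D}_B$, the loss covariance under the probe distribution vanishes: $$K(z, z') = \mathrm{Cov}_{w \sim p(w \mid \mathcal{D})}\left[\ell(z; w_A), \ell(z'; w_B)\right] = 0.$$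
   Context: The total training loss is $L(w) = \sum_{z \in \mathcal{D}} \ell(z; w)$. The probe distribution is the probability distribution on $\mathbb{R}^d$ with density (with respect to Lebesgue measure) $$p(w \mid \mathcal{D}) \propto \exp(-\beta L(w)) \cdot \mathcal{N}(w \mid w^*, \gamma^{-1} I),$$ where $\mathcal{N}(w \mid w^*, \gamma^{-1} I) \propto \exp\left(-\frac{\gamma}{2}\|w - w^*\|^2\right)$ is the spherical Gaussian density with mean $w^*$ (the trained parameter) and covariance $\gamma^{-1} I$. The loss kernel is $K(z, z') = \mathrm{Cov}_{w \sim p(w \mid \mathcal{D})}[\ell(z; w), \ell(z'; w)]$, where $\mathrm{Cov}[X, Y] = \mathbb{E}[XY] - \mathbb{E}[X]\mathbb{E}[Y]$. It is assumed that these objects are well defined: $w \mapsto \ell(z; w)$ is measurable for each $z \in \mathcal{D}$, the normalizing constant of $p(w \mid \mathcal{D})$ is finite and positive, and the per-sample losses of points of $\mathcal{D}$ have finite second moments under $p(w \mid \mathcal{D})$. *)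

theory Defs
  imports "HOL-Probability.Probability"
begin

definition function_of_coords :: "'d set \<Rightarrow> (real ^ 'd \<Rightarrow> real) \<Rightarrow> bool" where
  "function_of_coords A f \<longleftrightarrow> (\<exists>g. \<forall>w. f w = g (\<lambda>i\<in>A. w $ i))"

definition covariance :: "'a measure \<Rightarrow> ('a \<Rightarrow> real) \<Rightarrow> ('a \<Rightarrow> real) \<Rightarrow> real" where
  "covariance M X Y = (LINT x|M. X x * Y x) - (LINT x|M. X x) * (LINT x|M. Y x)"

(* The parameter gamma is the precision, so the covariance matrix is I / gamma. *)
definition spherical_gaussian :: "real ^ 'd \<Rightarrow> real \<Rightarrow> real ^ 'd \<Rightarrow> real" where
  "spherical_gaussian \<mu> \<gamma> w =
     (\<gamma> / (2 * pi)) powr (real CARD('d) / 2) * exp (- (\<gamma> / 2) * (norm (w - \<mu>))\<^sup>2)"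

definition total_loss :: "('z \<Rightarrow> real ^ 'd \<Rightarrow> real) \<Rightarrow> 'z set \<Rightarrow> real ^ 'd \<Rightarrow> real" where
  "total_loss l D w = (\<Sum>z\<in>D. l z w)"

definition probe_weight ::
  "real \<Rightarrow> real \<Rightarrow> real ^ 'd \<Rightarrow> ('z \<Rightarrow> real ^ 'd \<Rightarrow> real) \<Rightarrow> 'z set \<Rightarrow> real ^ 'd \<Rightarrow> real" where
  "probe_weight \<beta> \<gamma> wstar l D w =
     exp (- \<beta> * total_loss l D w) * spherical_gaussian wstar \<gamma> w"

definition probe_normalizer ::
  "real \<Rightarrow> real \<Rightarrow> real ^ 'd \<Rightarrow> ('z \<Rightarrow> real ^ 'd \<Rightarrow> real) \<Rightarrow> 'z set \<Rightarrow> ennreal" where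
  "probe_normalizer \<beta> \<gamma> wstar l D = (\<integral>\<^sup>+ w. ennreal (probe_weight \<beta> \<gamma> wstar l D w) \<partial>lborel)"

definition probe_distribution ::
  "real \<Rightarrow> real \<Rightarrow> real ^ 'd \<Rightarrow> ('z \<Rightarrow> real ^ 'd \<Rightarrow> real) \<Rightarrow> 'z set \<Rightarrow> (real ^ 'd) measure" where
  "probe_distribution \<beta> \<gamma> wstar l D =
     density lborel
       (\<lambda>w. ennreal (probe_weight \<beta> \<gamma> wstar l D w) / probe_normalizer \<beta> \<gamma> wstar l D)"

definition loss_kernel ::
  "real \<Rightarrow> real \<Rightarrow> real ^ 'd \<Rightarrow> ('z \<Rightarrow> real ^ 'd \<Rightarrow> real) \<Rightarrow> 'z set \<Rightarrow> 'z \<Rightarrow> 'z \<Rightarrow> real" where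
  "loss_kernel \<beta> \<gamma> wstar l D z z' =
     covariance (probe_distribution \<beta> \<gamma> wstar l D) (l z) (l z')"

end

theory Submission
  imports Defs
begin

text \<open>
  Draw two independent parameters \<open>w\<close>, \<open>u\<close> from the probe distribution and exchange their
  coordinates outside \<open>A\<close>.  Every loss of a data point, and every squared coordinate distance to the
  mean, satisfies \<open>f w + f u = f w' + f u'\<close> for the exchanged pair, so the joint density, and with it
  the joint law, is invariant.  The exchange turns \<open>l z w * l z' u\<close> into \<open>l z w * l z' w\<close>; taking
  expectations gives \<open>E[l z] * E[l z'] = E[l z * l z']\<close>.
\<close>

text \<open>By \<open>adj\<close> the coordinate of \<open>T x\<close> along \<open>b\<close> is
  that of \<open>x\<close> along \<open>T b\<close>, so \<open>T\<close> only permutes coordinates.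
  It carries boxes to boxes with permuted side lengths, and Lebesgue measure is determined by the
  volumes of boxes.\<close>

lemma distr_lborel_basis_involution:
  fixes T :: "'a::euclidean_space \<Rightarrow> 'a"
  assumes T: "T \<in> borel_measurable borel" and invol: "\<And>x. T (T x) = x"
    and adj: "\<And>x y. T x \<bullet> y = x \<bullet> T y" and Basis: "\<And>b. b \<in> Basis \<Longrightarrow> T b \<in> Basis"
  shows "distr lborel borel T = lborel"
proof (rule sym, rule lborel_eqI)
  fix l u :: 'a
  assume le: "\<And>b. b \<in> Basis \<Longrightarrow> l \<bullet> b \<le> u \<bullet> b"
  have "T x \<in> box l u \<longleftrightarrow> x \<in> box (T l) (T u)" for x
    using Basis invol by (simp add: mem_box adj) metis
  then have "T -` box l u = box (T l) (T u)"
    by auto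
  then have "emeasure (distr lborel borel T) (box l u) = emeasure lborel (box (T l) (T u))"
    using T by (simp add: emeasure_distr)
  \<comment> \<open>The new corners are still ordered: \<open>adj\<close> turns their comparison
    along \<open>b\<close> into the assumed one along \<open>T b\<close>.\<close>
  also have "\<dots> = (\<Prod>b\<in>Basis. (T u - T l) \<bullet> b)"
    using le Basis by (simp add: adj)
  also have "(\<Prod>b\<in>Basis. (T u - T l) \<bullet> b) = (\<Prod>b\<in>Basis. (u - l) \<bullet> b)"
    by (rule prod.reindex_bij_witness[of _ T T])
      (auto simp: Basis invol adj inner_diff_left)
  finally show "emeasure (distr lborel borel T) (box l u) = (\<Prod>b\<in>Basis. (u - l) \<bullet> b)" .
qed simp

definition exchange_off ::
  "'d set \<Rightarrow> (real ^ 'd) \<times> (real ^ 'd) \<Rightarrow> (real ^ 'd) \<times> (real ^ 'd)" where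
  "exchange_off A = (\<lambda>(w, u). (\<chi> i. if i \<in> A then w $ i else u $ i, \<chi> i. if i \<in> A then u $ i else w $ i))"

lemma exchange_off_measurable [measurable]:
  fixes A :: "'d::finite set"
  shows "exchange_off A \<in> borel_measurable borel"
proof (rule borel_measurable_continuous_onI)
  have "continuous_on UNIV (\<lambda>p::(real ^ 'd) \<times> (real ^ 'd). if i \<in> A then fst p $ i else snd p $ i)"
    "continuous_on UNIV (\<lambda>p::(real ^ 'd) \<times> (real ^ 'd). if i \<in> A then snd p $ i else fst p $ i)" for i
    by (cases "i \<in> A"; simp; intro continuous_intros)+
  then show "continuous_on UNIV (exchange_off A)"
    unfolding exchange_off_def case_prod_unfold
    by (intro continuous_on_Pair continuous_on_vec_lambda)
qed

text \<open>The exchange permutes the standard basis of the product space: a basis vector at index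
  \<open>k\<close> stays put if \<open>k\<close> is in \<open>A\<close> and moves to the other
  factor otherwise.\<close>

lemma distr_lborel_exchange_off: "distr lborel borel (exchange_off A) = lborel"
proof (rule distr_lborel_basis_involution)
  show "exchange_off A (exchange_off A p) = p" for p
    by (cases p) (simp add: exchange_off_def vec_eq_iff)
  show "exchange_off A p \<bullet> q = p \<bullet> exchange_off A q" for p q
    by (cases p; cases q)
      (auto simp: exchange_off_def inner_vec_def sum.distrib[symmetric] intro!: sum.cong)
  show "exchange_off A p \<in> Basis" if "p \<in> Basis" for p
  proof -
    from that obtain k where k: "p = (axis k 1, 0) \<or> p = (0, axis k 1)"
      by (auto simp: Basis_prod_def Basis_vec_def)
    then have "exchange_off A p = (axis k 1, 0) \<or> exchange_off A p = (0, axis k 1)"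
      by (cases "k \<in> A") (auto simp: exchange_off_def vec_eq_iff axis_def split: if_splits)
    then show ?thesis
      by (auto simp: Basis_prod_def Basis_vec_def)
  qed
qed simp

lemma function_of_coords_cong:
  assumes "function_of_coords A f" and "\<And>i. i \<in> A \<Longrightarrow> w $ i = u $ i"
  shows "f w = f u"
proof -
  from assms(2) have "(\<lambda>i\<in>A. w $ i) = (\<lambda>i\<in>A. u $ i)"
    by (auto simp: restrict_def)
  with assms(1) show ?thesis
    unfolding function_of_coords_def by metis
qed

text \<open>The point \<open>w'\<close> has the coordinates of \<open>w\<close> on \<open>A\<close>
  and those of \<open>u\<close> off \<open>A\<close>; for \<open>u'\<close> the roles are reversed.
  Disjointness places \<open>B\<close> off \<open>A\<close>, so functions of \<open>A\<close> keep
  their two values and functions of \<open>B\<close> trade them.\<close>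

lemma function_of_coords_exchange_off:
  assumes "exchange_off A (w, u) = (w', u')"
  shows "function_of_coords A f \<Longrightarrow> f w' = f w" "function_of_coords A f \<Longrightarrow> f u' = f u"
    and "A \<inter> B = {} \<Longrightarrow> function_of_coords B f \<Longrightarrow> f w' = f u"
    and "A \<inter> B = {} \<Longrightarrow> function_of_coords B f \<Longrightarrow> f u' = f w"
proof -
  have on: "w' $ i = w $ i" "u' $ i = u $ i" if "i \<in> A" for i
    using assms that by (auto simp: exchange_off_def)
  have off: "w' $ i = u $ i" "u' $ i = w $ i" if "i \<notin> A" for i
    using assms that by (auto simp: exchange_off_def)
  show "f w' = f w" "f u' = f u" if "function_of_coords A f"
    using on by (auto intro: function_of_coords_cong[OF that])
  show "f w' = f u" "f u' = f w" if "A \<inter> B = {}" "function_of_coords B f"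
    using off that(1) by (auto intro: function_of_coords_cong[OF that(2)])
qed

text \<open>A weight is a constant times the exponential of \<open>E\<close>, which is a sum over
  data points and coordinates. The exchange keeps or swaps each pair of corresponding terms, hence
  preserves the total of \<open>E\<close> over both points.\<close>

lemma probe_weight_exchange_off:
  fixes A B :: "'d::finite set"
  assumes "\<And>x. x \<in> D \<Longrightarrow> function_of_coords A (l x) \<or> function_of_coords B (l x)"
    and "A \<inter> B = {}" and ex: "exchange_off A (w, u) = (w', u')"
  shows "probe_weight \<beta> \<gamma> m l D w' * probe_weight \<beta> \<gamma> m l D u' =
    probe_weight \<beta> \<gamma> m l D w * probe_weight \<beta> \<gamma> m l D u"
proof -
  have "l x w' + l x u' = l x w + l x u" if "x \<in> D" for x
    using assms(1)[OF that]
  proof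
    assume "function_of_coords A (l x)"
    then show ?thesis
      by (simp only: function_of_coords_exchange_off(1,2)[OF ex])
  next
    assume "function_of_coords B (l x)"
    then show ?thesis
      by (simp only: function_of_coords_exchange_off(3,4)[OF ex assms(2)] add.commute)
  qed
  then have loss: "total_loss l D w' + total_loss l D u' = total_loss l D w + total_loss l D u"
    by (simp add: total_loss_def sum.distrib[symmetric])
  \<comment> \<open>The squared norm splits into coordinates, and both points are compared with the
    same centre \<open>m\<close>, so swapping their entries at one index leaves the sum
    unchanged.\<close>
  have norm: "(norm (w' - m))\<^sup>2 + (norm (u' - m))\<^sup>2 = (norm (w - m))\<^sup>2 + (norm (u - m))\<^sup>2"
    using ex
    by (auto simp: exchange_off_def power2_norm_eq_inner inner_vec_def sum.distrib[symmetric]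
        intro!: sum.cong)
  define E where "E a = - \<beta> * total_loss l D a + - (\<gamma> / 2) * (norm (a - m))\<^sup>2" for a
  have "E w' + E u' = - \<beta> * (total_loss l D w' + total_loss l D u')
      + - (\<gamma> / 2) * ((norm (w' - m))\<^sup>2 + (norm (u' - m))\<^sup>2)"
    unfolding E_def by (simp only: distrib_left add_ac)
  also have "\<dots> = E w + E u"
    unfolding E_def loss norm by (simp only: distrib_left add_ac)
  finally have "exp (E w') * exp (E u') = exp (E w) * exp (E u)"
    by (simp only: exp_add[symmetric])
  moreover have "probe_weight \<beta> \<gamma> m l D a * probe_weight \<beta> \<gamma> m l D b =
      ((\<gamma> / (2 * pi)) powr (real CARD('d) / 2))\<^sup>2 * (exp (E a) * exp (E b))" for a b
    by (simp only: probe_weight_def spherical_gaussian_def E_def exp_add power2_eq_square mult_ac)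
  ultimately show ?thesis
    by simp
qed

text \<open>The product law has density \<open>H\<close> with respect to Lebesgue measure on the
  product space. Both that measure and \<open>H\<close> are invariant under \<open>T\<close>, so
  their combination is too.\<close>

lemma distr_pair_density_lborel:
  fixes h :: "'a::euclidean_space \<Rightarrow> ennreal"
  assumes [measurable]: "h \<in> borel_measurable borel" "T \<in> borel_measurable borel"
    and sf: "sigma_finite_measure (density lborel h)"
    and T: "distr lborel borel T = lborel"
    and inv: "\<And>w u w' u'. T (w, u) = (w', u') \<Longrightarrow> h w' * h u' = h w * h u"
  defines "P \<equiv> density lborel h"
  shows "distr (P \<Otimes>\<^sub>M P) borel T = P \<Otimes>\<^sub>M P"
proof -
  define H where "H = (\<lambda>(w, u). h w * h u)"
  have [measurable]: "H \<in> borel_measurable borel"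
    unfolding H_def borel_prod[symmetric] by measurable
  have HT: "(\<lambda>p. H (T p)) = H"
    using inv by (auto simp: H_def fun_eq_iff split: prod.splits)
  have PP: "P \<Otimes>\<^sub>M P = density lborel H"
    unfolding P_def H_def
    by (subst pair_measure_density) (auto simp: sf lborel.sigma_finite_measure_axioms lborel_prod)
  have "distr (density lborel H) borel T = density (distr lborel borel T) H"
    using density_distr[of H borel T lborel] by (simp add: HT)
  then show ?thesis
    by (simp add: PP T)
qed

lemma probe_weight_measurable:
  assumes "\<And>x. x \<in> D \<Longrightarrow> l x \<in> borel_measurable borel"
  shows "probe_weight \<beta> \<gamma> m l D \<in> borel_measurable borel"
proof -
  have [measurable]: "total_loss l D \<in> borel_measurable borel"
    unfolding total_loss_def using assms by simp
  show ?thesis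
    unfolding probe_weight_def spherical_gaussian_def by measurable
qed

lemma prob_space_probe_distribution:
  assumes "\<And>x. x \<in> D \<Longrightarrow> l x \<in> borel_measurable borel"
    and "probe_normalizer \<beta> \<gamma> m l D > 0" and "probe_normalizer \<beta> \<gamma> m l D < \<infinity>"
  shows "prob_space (probe_distribution \<beta> \<gamma> m l D)"
proof
  note probe_weight_measurable[OF assms(1), measurable]
  have "emeasure (probe_distribution \<beta> \<gamma> m l D) UNIV =
      probe_normalizer \<beta> \<gamma> m l D / probe_normalizer \<beta> \<gamma> m l D"
    by (simp add: probe_distribution_def emeasure_density nn_integral_divide
        probe_normalizer_def)
  \<comment> \<open>In \<open>ennreal\<close> a quotient of equal terms is 1 only away from 0 and
    infinity, so both bounds on the normalizer enter here.\<close>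
  also have "\<dots> = 1"
    using assms(2,3) by (simp add: ennreal_divide_self)
  finally show "emeasure (probe_distribution \<beta> \<gamma> m l D)
      (space (probe_distribution \<beta> \<gamma> m l D)) = 1"
    by (simp add: probe_distribution_def)
qed

text \<open>By Fubini, the inner integral at \<open>x\<close> is \<open>f x\<close> times the
  constant integral of \<open>g\<close>.\<close>

lemma (in prob_space) integral_pair_product:
  fixes f g :: "'a \<Rightarrow> real"
  assumes f: "integrable M f" and g: "integrable M g"
  shows "(LINT p|(M \<Otimes>\<^sub>M M). f (fst p) * g (snd p)) = (LINT x|M. f x) * (LINT x|M. g x)"
proof -
  interpret pair_sigma_finite M M ..
  have "integrable (M \<Otimes>\<^sub>M M) (\<lambda>p. f (fst p) * g (snd p))"
    using f g by (intro Fubini_integrable) (auto simp: abs_mult)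
  from integral_fst'[OF this] show ?thesis
    by simp
qed

theorem proposition2:
  fixes A B :: "'d::finite set"
    and D D\<^sub>A D\<^sub>B :: "'z set"
    and l :: "'z \<Rightarrow> real ^ 'd \<Rightarrow> real"
    and wstar :: "real ^ 'd"
    and \<beta> \<gamma> :: real
    and z z' :: 'z
  assumes "A \<union> B = UNIV" and "A \<inter> B = {}"
    and "finite D" and "D = D\<^sub>A \<union> D\<^sub>B" and "D\<^sub>A \<inter> D\<^sub>B = {}"
    and "\<And>x. x \<in> D\<^sub>A \<Longrightarrow> function_of_coords A (l x)"
    and "\<And>x. x \<in> D\<^sub>B \<Longrightarrow> function_of_coords B (l x)"
    and "\<beta> > 0" and "\<gamma> > 0"
    and "\<And>x. x \<in> D \<Longrightarrow> l x \<in> borel_measurable borel"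
    and "probe_normalizer \<beta> \<gamma> wstar l D > 0"
    and "probe_normalizer \<beta> \<gamma> wstar l D < \<infinity>"
    and "\<And>x. x \<in> D \<Longrightarrow> integrable (probe_distribution \<beta> \<gamma> wstar l D) (\<lambda>w. (l x w)\<^sup>2)"
    and "z \<in> D\<^sub>A" and "z' \<in> D\<^sub>B"
  shows "loss_kernel \<beta> \<gamma> wstar l D z z' = 0"
proof -
  define P where "P = probe_distribution \<beta> \<gamma> wstar l D"
  define h where
    "h = (\<lambda>w. ennreal (probe_weight \<beta> \<gamma> wstar l D w) / probe_normalizer \<beta> \<gamma> wstar l D)"
  define T where "T = exchange_off A"
  interpret P: prob_space P
    using prob_space_probe_distribution[OF assms(10-12)] by (simp add: P_def)
  have P_h: "P = density lborel h"
    by (simp add: P_def h_def probe_distribution_def)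
  have sets_P [measurable_cong]: "sets P = sets borel"
    by (simp add: P_h)
  have [measurable]: "h \<in> borel_measurable borel"
    unfolding h_def using probe_weight_measurable[OF assms(10)] by measurable
  have "z \<in> D" "z' \<in> D"
    using assms by auto
  then have [measurable]: "l z \<in> borel_measurable borel" "l z' \<in> borel_measurable borel"
    using assms(10) by auto
  have zA: "function_of_coords A (l z)" and z'B: "function_of_coords B (l z')"
    using assms by auto
  \<comment> \<open>On a probability space finite second moments give finite first moments, which
    Fubini requires below.\<close>
  have int: "integrable P (l z)" "integrable P (l z')"
    by (rule P.square_integrable_imp_integrable;
        use assms(13)[folded P_def] \<open>z \<in> D\<close> \<open>z' \<in> D\<close> in \<open>simp add: measurable_cong_sets[OF sets_P refl]\<close>)+
  have inv: "h w' * h u' = h w * h u" if "T (w, u) = (w', u')" for w u w' u'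
  proof -
    have nonneg: "probe_weight \<beta> \<gamma> wstar l D a \<ge> 0" for a
      by (simp add: probe_weight_def spherical_gaussian_def)
    have "probe_weight \<beta> \<gamma> wstar l D w' * probe_weight \<beta> \<gamma> wstar l D u' =
        probe_weight \<beta> \<gamma> wstar l D w * probe_weight \<beta> \<gamma> wstar l D u"
      using that assms(2,4,6,7) unfolding T_def
      by (intro probe_weight_exchange_off[where A = A and B = B]) auto
    \<comment> \<open>The normalizer enters only as a common squared factor; nonnegativity lets
      \<open>ennreal\<close> pass through the product of weights.\<close>
    moreover have "h a * h b = ennreal (probe_weight \<beta> \<gamma> wstar l D a * probe_weight \<beta> \<gamma> wstar l D b)
        * (inverse (probe_normalizer \<beta> \<gamma> wstar l D))\<^sup>2" for a b
      by (simp add: h_def divide_ennreal_def ennreal_mult nonneg power2_eq_square ac_simps)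
    ultimately show ?thesis
      by simp
  qed
  have T: "distr (P \<Otimes>\<^sub>M P) borel T = P \<Otimes>\<^sub>M P"
    unfolding P_h
    by (rule distr_pair_density_lborel)
      (use inv P.sigma_finite_measure_axioms in
        \<open>auto simp: T_def distr_lborel_exchange_off P_h\<close>)
  have [measurable]: "T \<in> P \<Otimes>\<^sub>M P \<rightarrow>\<^sub>M borel"
    unfolding T_def
    by (subst measurable_cong_sets[OF sets_pair_measure_cong[OF sets_P sets_P] refl])
      (simp add: borel_prod)
  have prod_borel: "(\<lambda>p. l z (fst p) * l z' (snd p)) \<in> borel_measurable borel"
    unfolding borel_prod[symmetric] by measurable
  \<comment> \<open>The second exchanged point has the \<open>B\<close> coordinates of the first
    original point, so both losses are evaluated there.\<close>
  have T_prod: "l z (fst (T p)) * l z' (snd (T p)) = l z (fst p) * l z' (fst p)" for p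
  proof -
    have ex: "exchange_off A (fst p, snd p) = (fst (T p), snd (T p))"
      by (simp add: T_def)
    show ?thesis
      by (simp only: function_of_coords_exchange_off(1)[OF ex zA]
          function_of_coords_exchange_off(4)[OF ex assms(2) z'B])
  qed
  have "(LINT w|P. l z w) * (LINT w|P. l z' w) = (LINT p|(P \<Otimes>\<^sub>M P). l z (fst p) * l z' (snd p))"
    by (rule P.integral_pair_product[OF int, symmetric])
  also have "\<dots> = (LINT p|distr (P \<Otimes>\<^sub>M P) borel T. l z (fst p) * l z' (snd p))"
    by (simp add: T)
  also have "\<dots> = (LINT p|(P \<Otimes>\<^sub>M P). l z (fst p) * l z' (fst p))"
    by (subst integral_distr) (simp_all add: prod_borel T_prod)
  \<comment> \<open>Only the first component is left in the integrand, and its marginal law is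
    \<open>P\<close>.\<close>
  also have "\<dots> = (LINT w|distr (P \<Otimes>\<^sub>M P) P fst. l z w * l z' w)"
    by (subst integral_distr) simp_all
  also have "\<dots> = (LINT w|P. l z w * l z' w)"
    by (simp add: P.distr_pair_fst)
  finally show ?thesis
    by (simp add: loss_kernel_def covariance_def P_def)
qed

end
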